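(* Assume the oracle used is an $r$-approximation, $r\ge1$. With threshold payments, Random-OM$(0.5,A,B)$ is (universally) truthful, budget feasible, and in expectation achieves a $1+4r$ approximation of the optimum, i.e. $(1+4r)\,E[v(S)]\ge opt(A,B)$ where $S$ is its (random) winning set.
   Context: Setting. A buyer with budget $B>0$ faces a finite set $A$ of $n$ sellers. Seller $i$ owns one item (also called $i$) and has a private cost $c_i\ge 0$; his utility when selling at payment $p_i$ is $p_i-c_i$. The buyer's value $v:2^A\to\mathbb{R}_{\ge 0}$ is monotone non-decreasing and submodular. Write $v(i)=v(\{i\})$, $m_i(S)=v(S\cup\{i\})-v(S)$, $c(S)=\sum_{i\in S}c_i$, and $opt(A',B)=\max\{v(S):S\subseteq A',\ c(S)\le B\}$ for $A'\subseteq A$. Mechanisms. A deterministic allocation rule $f$ maps each declared cost vector $c$ to a winning set $f(c)\subseteq A$. Threshold payments: a winner $i$ is paid $p_i=\inf\{b: i\notin f(b,c_{-i})\}$, losers are paid $0$. A deterministic mechanism is truthful if declaring the true cost is always a dominant strategy for each seller; a randomized mechanism is universally truthful if it is a randomization over truthful deterministic mechanisms. It is budget feasible if for every cost vector (and every realization of the randomness) the total payment is at most $B$. Oracle. $Oracle(A',B)$ is a deterministic real-valued function of $A'\subseteq A$, $B$, $v$ and the declared costs of the sellers in $A'$ only, with $Oracle(A',B)\le opt(A',B)$; it is an $r$-approximation if also $r\cdot Oracle(A',B)\ge opt(A',B)$ always. Greedy order. $S_0=\emptyset$ and $S_i=S_{i-1}\cup\{\arg\max_{j\in A\setminus S_{i-1}}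 m_j(S_{i-1})/c_j\}$, ties broken by a fixed order on sellers; the ratio is $0$ if $m_j(S_{i-1})=0$ and $+\infty$ if $c_j=0<m_j(S_{i-1})$. Items are renamed so that $S_i\setminus S_{i-1}=\{i\}$. Greedy-OM$(\alpha,A,B)$: start with $S=\emptyset$; for $i=1,\dots,|A|$, add $i$ to $S$ if $v(S_i)\le\alpha\, Oracle(A\setminus\{i\},B)$; return $S$. Random-OM$(\alpha,A,B)$: replace $A$ by $\{i\in A:c_i\le B\}$ (return $\emptyset$ if this is empty); let $i^*\in\arg\max_{i\in A}v(i)$; with probability $\frac{r}{\alpha+2r}$ return Greedy-OM$(\alpha,A,B)$, otherwise return $\{i^*\}$.
   Formalization: Budget feasibility is claimed only if at most one seller i has v(i)=0: with two such sellers, and all others costing more than B, both win at every bid up to B and are paid 2B in total. Ties for i* are broken independently of the declared costs. *)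

theory Defs
  imports "HOL-Probability.Probability"
begin

definition submodular_on :: "'a set \<Rightarrow> ('a set \<Rightarrow> real) \<Rightarrow> bool" where
  "submodular_on A v \<longleftrightarrow>
     (\<forall>S T. S \<subseteq> A \<longrightarrow> T \<subseteq> A \<longrightarrow> v (S \<union> T) + v (S \<inter> T) \<le> v S + v T)"

text \<open>Normalisation \<open>v {} = 0\<close> is deliberately not required.\<close>

definition valuation :: "'a set \<Rightarrow> ('a set \<Rightarrow> real) \<Rightarrow> bool" where
  "valuation A v \<longleftrightarrow> (\<forall>S\<subseteq>A. 0 \<le> v S) \<and> mono_on (Pow A) v \<and> submodular_on A v"

definition marginal :: "('a set \<Rightarrow> real) \<Rightarrow> 'a set \<Rightarrow> 'a \<Rightarrow> real" where
  "marginal v S i = v (insert i S) - v S"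

text \<open>Cost vectors are total functions; only their values on the sellers in question matter.\<close>

definition cost_vector :: "'a set \<Rightarrow> ('a \<Rightarrow> real) \<Rightarrow> bool" where
  "cost_vector A c \<longleftrightarrow> (\<forall>i\<in>A. 0 \<le> c i)"

definition opt :: "('a set \<Rightarrow> real) \<Rightarrow> 'a set \<Rightarrow> real \<Rightarrow> ('a \<Rightarrow> real) \<Rightarrow> real" where
  "opt v A B c = Max (v ` {S. S \<subseteq> A \<and> sum c S \<le> B})"

type_synonym 'a alloc = "('a \<Rightarrow> real) \<Rightarrow> 'a set"
type_synonym 'a mechanism = "'a alloc \<times> (('a \<Rightarrow> real) \<Rightarrow> 'a \<Rightarrow> real)"

text \<open>The infimum is over admissible (nonnegative) bids. It is only meaningful if some bid of
  \<open>i\<close> loses, because \<open>Inf {}\<close> is unspecified on the reals; the rules below reject every bid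
  exceeding the budget.\<close>

definition threshold_payment :: "'a alloc \<Rightarrow> ('a \<Rightarrow> real) \<Rightarrow> 'a \<Rightarrow> real" where
  "threshold_payment f c i = (if i \<in> f c then Inf {b. 0 \<le> b \<and> i \<notin> f (c(i := b))} else 0)"

definition with_threshold_payments :: "'a alloc \<Rightarrow> 'a mechanism" where
  "with_threshold_payments f = (f, threshold_payment f)"

definition utility :: "'a mechanism \<Rightarrow> 'a \<Rightarrow> real \<Rightarrow> ('a \<Rightarrow> real) \<Rightarrow> real" where
  "utility M i t d = snd M d i - (if i \<in> fst M d then t else 0)"

text \<open>Here \<open>c i\<close> is the true cost of \<open>i\<close>, while the other entries of \<open>c\<close> are arbitrary
  declarations of the other sellers.\<close>

definition truthful :: "'a set \<Rightarrow> 'a mechanism \<Rightarrow> bool" where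
  "truthful A M \<longleftrightarrow>
     (\<forall>c. cost_vector A c \<longrightarrow>
       (\<forall>i\<in>A. \<forall>b\<ge>0. utility M i (c i) (c(i := b)) \<le> utility M i (c i) c))"

text \<open>A randomized mechanism is a distribution over deterministic mechanisms, drawn before (and
  hence independently of) the declarations.\<close>

definition universally_truthful :: "'a set \<Rightarrow> 'a mechanism pmf \<Rightarrow> bool" where
  "universally_truthful A R \<longleftrightarrow> (\<forall>M\<in>set_pmf R. truthful A M)"

definition budget_feasible :: "'a set \<Rightarrow> real \<Rightarrow> 'a mechanism pmf \<Rightarrow> bool" where
  "budget_feasible A B R \<longleftrightarrow>
     (\<forall>M\<in>set_pmf R. \<forall>c. cost_vector A c \<longrightarrow> (\<Sum>i\<in>A. snd M c i) \<le> B)"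

text \<open>The publicly known valuation \<open>v\<close> is fixed, so an oracle is a function of the set of
  sellers, the budget and the declared costs.\<close>

type_synonym 'a oracle_fun = "'a set \<Rightarrow> real \<Rightarrow> ('a \<Rightarrow> real) \<Rightarrow> real"

definition is_oracle :: "'a set \<Rightarrow> ('a set \<Rightarrow> real) \<Rightarrow> 'a oracle_fun \<Rightarrow> bool" where
  "is_oracle A v Orc \<longleftrightarrow>
     (\<forall>A'\<subseteq>A. \<forall>B>0. \<forall>c. cost_vector A' c \<longrightarrow>
        Orc A' B c \<le> opt v A' B c \<and>
        (\<forall>c'. (\<forall>i\<in>A'. c' i = c i) \<longrightarrow> Orc A' B c' = Orc A' B c))"

definition approx_oracle :: "'a set \<Rightarrow> ('a set \<Rightarrow> real) \<Rightarrow> real \<Rightarrow> 'a oracle_fun \<Rightarrow> bool" where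
  "approx_oracle A v r Orc \<longleftrightarrow> is_oracle A v Orc \<and>
     (\<forall>A'\<subseteq>A. \<forall>B>0. \<forall>c. cost_vector A' c \<longrightarrow> opt v A' B c \<le> r * Orc A' B c)"

definition greedy_ratio :: "('a set \<Rightarrow> real) \<Rightarrow> ('a \<Rightarrow> real) \<Rightarrow> 'a set \<Rightarrow> 'a \<Rightarrow> ereal" where
  "greedy_ratio v c S j =
     (if marginal v S j = 0 then 0
      else if c j = 0 then \<infinity>
      else ereal (marginal v S j / c j))"

text \<open>Ties are broken by the order of the seller type. Positions are counted from 0: the item at
  position \<open>k\<close> is \<open>greedy_item A v c k\<close>, and \<open>greedy_prefix A v c k\<close> consists of the first \<open>k\<close>
  items. Both are meaningful as long as not all of \<open>A\<close> has been used up.\<close>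

definition greedy_next ::
    "'a::linorder set \<Rightarrow> ('a set \<Rightarrow> real) \<Rightarrow> ('a \<Rightarrow> real) \<Rightarrow> 'a set \<Rightarrow> 'a" where
  "greedy_next A v c S = Min {j. is_arg_max (greedy_ratio v c S) (\<lambda>k. k \<in> A - S) j}"

primrec greedy_prefix ::
    "'a::linorder set \<Rightarrow> ('a set \<Rightarrow> real) \<Rightarrow> ('a \<Rightarrow> real) \<Rightarrow> nat \<Rightarrow> 'a set" where
  "greedy_prefix A v c 0 = {}"
| "greedy_prefix A v c (Suc k) =
     insert (greedy_next A v c (greedy_prefix A v c k)) (greedy_prefix A v c k)"

definition greedy_item ::
    "'a::linorder set \<Rightarrow> ('a set \<Rightarrow> real) \<Rightarrow> ('a \<Rightarrow> real) \<Rightarrow> nat \<Rightarrow> 'a" where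
  "greedy_item A v c k = greedy_next A v c (greedy_prefix A v c k)"

definition greedy_OM ::
    "('a::linorder set \<Rightarrow> real) \<Rightarrow> 'a oracle_fun \<Rightarrow> real \<Rightarrow> 'a set \<Rightarrow> real \<Rightarrow> 'a alloc" where
  "greedy_OM v Orc \<alpha> A B c =
     {greedy_item A v c k | k. k < card A \<and>
        v (greedy_prefix A v c (Suc k)) \<le> \<alpha> * Orc (A - {greedy_item A v c k}) B c}"

text \<open>\<open>istar A'\<close> is the selected most valuable seller of \<open>A'\<close>. The selection may break ties
  arbitrarily, but only as a function of the set \<open>A'\<close>, not of the declared costs.\<close>

definition random_OM_run ::
    "('a::linorder set \<Rightarrow> real) \<Rightarrow> 'a oracle_fun \<Rightarrow> ('a set \<Rightarrow> 'a) \<Rightarrow> real \<Rightarrow> 'a set \<Rightarrow> real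
       \<Rightarrow> bool \<Rightarrow> 'a alloc" where
  "random_OM_run v Orc istar \<alpha> A B coin c =
     (let A' = {i \<in> A. c i \<le> B} in
      if A' = {} then {}
      else if coin then greedy_OM v Orc \<alpha> A' B c
      else {istar A'})"

definition random_OM ::
    "('a::linorder set \<Rightarrow> real) \<Rightarrow> 'a oracle_fun \<Rightarrow> real \<Rightarrow> ('a set \<Rightarrow> 'a) \<Rightarrow> real \<Rightarrow> 'a set \<Rightarrow> real
       \<Rightarrow> 'a alloc pmf" where
  "random_OM v Orc r istar \<alpha> A B =
     map_pmf (random_OM_run v Orc istar \<alpha> A B) (bernoulli_pmf (r / (\<alpha> + 2 * r)))"

text \<open>Pitfall: if several affordable sellers have total value 0 (for instance \<open>v\<close> identically 0),
  the test of Greedy-OM reads \<open>0 \<le> 0\<close>, all of them win at every bid up to the budget \<open>B\<close>, and each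
  has threshold \<open>B\<close>, so the payments exceed \<open>B\<close>. By submodularity this requires two distinct
  sellers with \<open>v {i} = 0\<close>.\<close>

end

theory Submission
  imports Defs
begin

text \<open>Truthfulness holds because lowering a bid moves a seller forward in the greedy order
  without changing the prefix chosen before it, while the oracle value it is compared with
  ignores its bid.

  For budget feasibility, let \<open>S\<^sub>l\<close> be the greedy prefix up to the last winner, let \<open>S*\<close> be an
  optimal set, and suppose that a winner \<open>i\<close> still wins with a bid \<open>b\<close>, now coming right after a
  prefix \<open>T\<close>. Both winning tests yield \<open>v S* \<ge> 2 * v S\<^sub>l\<close> and \<open>v S* \<ge> 2 * v (insert i T)\<close>, hence
  \<open>v S\<^sub>l \<le> v S* - v (insert i T)\<close>. Since \<open>i\<close> has the best ratio after \<open>T\<close>, the right-hand side is at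
  most \<open>B\<close> times that ratio, so that \<open>b\<close> is at most \<open>B / v S\<^sub>l\<close> times the marginal value of \<open>i\<close> in
  the original order; these bounds sum up to at most \<open>B\<close>.

  For the approximation, the first rejected seller \<open>i\<close> satisfies
  \<open>opt - v {i} \<le> r * Oracle (A - {i}) < 2 * r * v S\<^sub>i\<close>, and all sellers before \<open>i\<close> win.\<close>

section \<open>Valuations\<close>

lemma valuation_nonneg: "valuation A v \<Longrightarrow> S \<subseteq> A \<Longrightarrow> 0 \<le> v S"
  by (auto simp: valuation_def)

lemma valuation_mono: "valuation A v \<Longrightarrow> S \<subseteq> T \<Longrightarrow> T \<subseteq> A \<Longrightarrow> v S \<le> v T"
  unfolding valuation_def mono_on_def by blast

lemma valuation_subset: "valuation A v \<Longrightarrow> X \<subseteq> A \<Longrightarrow> valuation X v"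
  unfolding valuation_def submodular_on_def mono_on_def by (meson PowD PowI subset_trans)

lemma marginal_nonneg: "valuation A v \<Longrightarrow> S \<subseteq> A \<Longrightarrow> i \<in> A \<Longrightarrow> 0 \<le> marginal v S i"
  unfolding marginal_def using valuation_mono[of A v S "insert i S"] by auto

text \<open>Diminishing returns: for \<open>i\<close> outside \<open>T\<close>, submodularity is
  applied to \<open>insert i S\<close> and \<open>T\<close>, which meet in \<open>S\<close>; for
  \<open>i\<close> in \<open>T\<close> the marginal over \<open>T\<close> is 0 and the other one
  nonnegative.\<close>

lemma marginal_antimono:
  assumes "valuation A v" "S \<subseteq> T" "T \<subseteq> A" "i \<in> A"
  shows "marginal v T i \<le> marginal v S i"
proof (cases "i \<in> T")
  case True
  then show ?thesis
    using marginal_nonneg[of A v S i] assms by (simp add: marginal_def insert_absorb)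
next
  case False
  have "insert i S \<subseteq> A"
    using assms by auto
  then have "v (insert i S \<union> T) + v (insert i S \<inter> T) \<le> v (insert i S) + v T"
    using assms(1,3) unfolding valuation_def submodular_on_def by blast
  moreover have "insert i S \<union> T = insert i T" "insert i S \<inter> T = S"
    using False assms by auto
  ultimately show ?thesis
    by (simp add: marginal_def)
qed

text \<open>The elements of \<open>S\<close> are added one at a time, and each adds at most its
  marginal value over \<open>T\<close> by diminishing returns.\<close>

lemma valuation_Un_le:
  assumes "valuation A v" "finite S" "S \<subseteq> A" "T \<subseteq> A"
  shows "v (T \<union> S) \<le> v T + (\<Sum>j\<in>S. marginal v T j)"
  using assms(2,3)
proof (induction S)
  case (insert x S)
  have "marginal v (T \<union> S) x \<le> marginal v T x"
    using insert assms by (intro marginal_antimono) auto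
  then show ?case
    using insert by (simp add: marginal_def)
qed simp

section \<open>The optimum\<close>

lemma opt_ge:
  assumes "finite A" "S \<subseteq> A" "sum c S \<le> B"
  shows "v S \<le> opt v A B c"
  unfolding opt_def using assms by (intro Max_ge) auto

lemma opt_attained:
  assumes "finite A" "B > 0"
  obtains S where "S \<subseteq> A" "sum c S \<le> B" "opt v A B c = v S"
proof -
  have "opt v A B c \<in> v ` {S. S \<subseteq> A \<and> sum c S \<le> B}"
    unfolding opt_def using assms by (intro Max_in) (auto intro!: exI[of _ "{}"])
  then show thesis
    using that by auto
qed

lemma opt_mono:
  assumes "finite A" "B > 0" "X \<subseteq> A"
  shows "opt v X B c \<le> opt v A B c"
proof -
  obtain S where "S \<subseteq> X" "sum c S \<le> B" "opt v X B c = v S"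
    using opt_attained[OF finite_subset[OF assms(3,1)] assms(2)] by blast
  then show ?thesis
    using opt_ge[OF assms(1), of S c B v] assms(3) by auto
qed

lemma opt_cong:
  assumes "\<And>i. i \<in> A \<Longrightarrow> c i = d i"
  shows "opt v A B c = opt v A B d"
proof -
  have "sum c S = sum d S" if "S \<subseteq> A" for S
    using assms that by (intro sum.cong) auto
  then show ?thesis
    unfolding opt_def by (simp cong: conj_cong)
qed

text \<open>As costs are nonnegative, a set within the budget has no member costing more than
  \<open>B\<close>; so discarding unaffordable sellers, as Random-OM does, loses nothing.\<close>

lemma opt_affordable:
  assumes "finite A" "B > 0" "cost_vector A c"
  shows "opt v A B c = opt v {i \<in> A. c i \<le> B} B c"
proof -
  have "S \<subseteq> {i \<in> A. c i \<le> B}" if "S \<subseteq> A" "sum c S \<le> B" for S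
  proof
    fix i assume "i \<in> S"
    then have "c i \<le> sum c S"
      using that assms finite_subset by (intro member_le_sum) (auto simp: cost_vector_def)
    then show "i \<in> {i \<in> A. c i \<le> B}"
      using that \<open>i \<in> S\<close> by auto
  qed
  then have "{S. S \<subseteq> A \<and> sum c S \<le> B} = {S. S \<subseteq> {i \<in> A. c i \<le> B} \<and> sum c S \<le> B}"
    by blast
  then show ?thesis
    unfolding opt_def by simp
qed

text \<open>Dropping \<open>i\<close> from an optimal set keeps it within the budget and loses at
  most the marginal value of \<open>i\<close> over the empty set, which is at most
  \<open>v {i}\<close> because \<open>v {}\<close> is nonnegative.\<close>

lemma opt_remove_le:
  assumes "finite A" "B > 0" "valuation A v" "cost_vector A c" "i \<in> A"
  shows "opt v A B c \<le> opt v (A - {i}) B c + v {i}"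
proof -
  obtain S where S: "S \<subseteq> A" "sum c S \<le> B" "opt v A B c = v S"
    using opt_attained[OF assms(1,2)] by blast
  have "finite S"
    using finite_subset[OF S(1) assms(1)] .
  have "v S \<le> v (insert i (S - {i}))"
    using S assms by (intro valuation_mono[of A]) auto
  also have "\<dots> = v (S - {i}) + marginal v (S - {i}) i"
    by (simp add: marginal_def)
  also have "marginal v (S - {i}) i \<le> marginal v {} i"
    using S assms by (intro marginal_antimono[of A]) auto
  also have "\<dots> \<le> v {i}"
    using valuation_nonneg[of A v "{}"] assms by (simp add: marginal_def)
  finally have "v S \<le> v (S - {i}) + v {i}"
    by simp
  moreover have "sum c (S - {i}) \<le> sum c S"
    using S assms \<open>finite S\<close> by (intro sum_mono2) (auto simp: cost_vector_def)
  then have "v (S - {i}) \<le> opt v (A - {i}) B c"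
    using S assms by (intro opt_ge) auto
  ultimately show ?thesis
    using S by simp
qed

section \<open>The greedy order\<close>

text \<open>The third property makes tie-breaking usable: two greedy choices coincide as soon as
  each is a maximizer in the setting of the other.\<close>

lemma greedy_next_properties:
  fixes A S :: "'a::linorder set" and v :: "'a set \<Rightarrow> real" and c :: "'a \<Rightarrow> real"
  assumes "finite A" "\<not> A \<subseteq> S"
  defines "j \<equiv> greedy_next A v c S"
  shows "j \<in> A - S"
    and "\<And>k. k \<in> A - S \<Longrightarrow> greedy_ratio v c S k \<le> greedy_ratio v c S j"
    and "\<And>k. is_arg_max (greedy_ratio v c S) (\<lambda>k. k \<in> A - S) k \<Longrightarrow> j \<le> k"
proof -
  let ?M = "{k. is_arg_max (greedy_ratio v c S) (\<lambda>k. k \<in> A - S) k}"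
  have "finite ?M"
    using assms by (auto simp: is_arg_max_def)
  moreover have fin: "finite (greedy_ratio v c S ` (A - S))" "greedy_ratio v c S ` (A - S) \<noteq> {}"
    using assms by auto
  obtain m where "m \<in> A - S" "greedy_ratio v c S m = Max (greedy_ratio v c S ` (A - S))"
    using Max_in[OF fin] by fastforce
  then have "m \<in> ?M"
    using Max_ge[OF fin(1)] by (simp add: is_arg_max_linorder)
  then have "?M \<noteq> {}"
    by blast
  ultimately have "j \<in> ?M"
    unfolding j_def greedy_next_def by (rule Min_in)
  have min: "\<And>k. k \<in> ?M \<Longrightarrow> j \<le> k"
    unfolding j_def greedy_next_def using \<open>finite ?M\<close> by (rule Min_le)
  from \<open>j \<in> ?M\<close> show "j \<in> A - S"
    and "\<And>k. k \<in> A - S \<Longrightarrow> greedy_ratio v c S k \<le> greedy_ratio v c S j"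
    by (auto simp: is_arg_max_linorder)
  show "\<And>k. is_arg_max (greedy_ratio v c S) (\<lambda>k. k \<in> A - S) k \<Longrightarrow> j \<le> k"
    using min by simp
qed

lemma greedy_prefix_subset_card:
  assumes "finite A" "k \<le> card A"
  shows "greedy_prefix A v c k \<subseteq> A \<and> card (greedy_prefix A v c k) = k"
  using assms(2)
proof (induction k)
  case (Suc k)
  let ?P = "greedy_prefix A v c k"
  have P: "?P \<subseteq> A" "card ?P = k" "finite ?P"
    using Suc assms finite_subset by auto
  moreover have "\<not> A \<subseteq> ?P"
    using P Suc.prems card_mono[of ?P A] by auto
  ultimately show ?case
    using greedy_next_properties(1)[OF assms(1), of ?P v c] by auto
qed simp

lemma greedy_prefix_subset: "finite A \<Longrightarrow> k \<le> card A \<Longrightarrow> greedy_prefix A v c k \<subseteq> A"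
  using greedy_prefix_subset_card by blast

lemma greedy_prefix_not_all:
  assumes "finite A" "k < card A"
  shows "\<not> A \<subseteq> greedy_prefix A v c k"
proof
  assume "A \<subseteq> greedy_prefix A v c k"
  then have "greedy_prefix A v c k = A"
    using greedy_prefix_subset[OF assms(1), of k v c] assms(2) by auto
  then show False
    using greedy_prefix_subset_card[OF assms(1), of k v c] assms(2) by simp
qed

lemma greedy_prefix_all: "finite A \<Longrightarrow> greedy_prefix A v c (card A) = A"
  using greedy_prefix_subset_card[of A "card A" v c] by (simp add: card_subset_eq)

lemma greedy_prefix_eq_image: "greedy_prefix A v c k = greedy_item A v c ` {..<k}"
  by (induction k) (auto simp: greedy_item_def lessThan_Suc)

declare greedy_prefix.simps(2) [simp del]

lemma greedy_prefix_Suc: "greedy_prefix A v c (Suc k) = insert (greedy_item A v c k) (greedy_prefix A v c k)"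
  by (simp add: greedy_prefix.simps(2) greedy_item_def)

lemma greedy_prefix_mono: "k \<le> l \<Longrightarrow> greedy_prefix A v c k \<subseteq> greedy_prefix A v c l"
  by (auto simp: greedy_prefix_eq_image)

lemma greedy_item_fresh:
  "finite A \<Longrightarrow> k < card A \<Longrightarrow> greedy_item A v c k \<in> A - greedy_prefix A v c k"
  unfolding greedy_item_def by (rule greedy_next_properties(1)[OF _ greedy_prefix_not_all])

lemma greedy_item_inj:
  assumes "finite A"
  shows "inj_on (greedy_item A v c) {..<card A}"
proof (rule linorder_inj_onI')
  fix k l assume "k \<in> {..<card A}" "l \<in> {..<card A}" "k < l"
  then have "greedy_item A v c k \<in> greedy_prefix A v c l"
    by (simp add: greedy_prefix_eq_image)
  then show "greedy_item A v c k \<noteq> greedy_item A v c l"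
    using greedy_item_fresh[OF assms, of l v c] \<open>l \<in> {..<card A}\<close> by auto
qed

lemma greedy_item_surj:
  assumes "finite A" "i \<in> A"
  obtains k where "k < card A" "greedy_item A v c k = i"
proof -
  have "i \<in> greedy_item A v c ` {..<card A}"
    using assms(2) greedy_prefix_all[OF assms(1)] by (simp add: greedy_prefix_eq_image[symmetric])
  then show thesis
    using that by blast
qed

section \<open>Effect of a lower bid on the greedy order\<close>

lemma greedy_ratio_le_cost:
  assumes "0 \<le> marginal v S i" "0 \<le> c' i" "c' i \<le> c i"
  shows "greedy_ratio v c S i \<le> greedy_ratio v c' S i"
  using assms by (auto simp: greedy_ratio_def intro!: divide_left_mono mult_pos_pos)

text \<open>Frees the comparison from extended values: since \<open>c i\<close> is positive, the
  ratio of \<open>i\<close> is finite, so a seller \<open>j\<close> with nonzero marginal must have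
  positive cost.\<close>

lemma greedy_ratio_leD:
  assumes "greedy_ratio v c S j \<le> greedy_ratio v c S i" "0 < c i" "0 \<le> c j"
    "0 \<le> marginal v S i" "0 \<le> marginal v S j"
  shows "marginal v S j \<le> c j * (marginal v S i / c i)"
proof (cases "marginal v S j = 0")
  case False
  then have "c j > 0"
    using assms by (auto simp: greedy_ratio_def split: if_splits)
  then have "marginal v S j / c j \<le> marginal v S i / c i"
    using assms False by (auto simp: greedy_ratio_def split: if_splits)
  then show ?thesis
    using \<open>c j > 0\<close> by (simp add: pos_divide_le_eq mult.commute)
qed (use assms in auto)

text \<open>A lower bid can only raise the ratio of \<open>i\<close> and leaves all others alone. As
  long as \<open>i\<close> is passed over even so, the choice among the others, ties included, is
  the same under both bids.\<close>

lemma greedy_prefix_lower_bid: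
  assumes "finite A" "valuation A v" "i \<in> A" "0 \<le> c' i" "c' i \<le> c i"
    and same: "\<And>j. j \<noteq> i \<Longrightarrow> c' j = c j"
    and "k \<le> card A" "i \<notin> greedy_prefix A v c' k"
  shows "greedy_prefix A v c' k = greedy_prefix A v c k"
  using assms(7,8)
proof (induction k)
  case (Suc k)
  let ?P = "greedy_prefix A v c k"
  have P: "greedy_prefix A v c' k = ?P"
    using Suc by (simp add: greedy_prefix_Suc)
  have PA: "?P \<subseteq> A" "\<not> A \<subseteq> ?P"
    using Suc.prems greedy_prefix_subset[OF assms(1), of k] greedy_prefix_not_all[OF assms(1), of k]
    by auto
  define j where "j = greedy_next A v c' ?P"
  define l where "l = greedy_next A v c ?P"
  note j = greedy_next_properties[where v = v and c = c', OF assms(1) PA(2), folded j_def]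
  note l = greedy_next_properties[where v = v and c = c, OF assms(1) PA(2), folded l_def]
  have "j \<noteq> i"
    using Suc.prems P by (auto simp: j_def greedy_prefix.simps(2))
  have le: "greedy_ratio v c ?P m \<le> greedy_ratio v c' ?P m" for m
    using marginal_nonneg[OF assms(2) PA(1) assms(3)] assms same
    by (cases "m = i") (auto simp: greedy_ratio_le_cost, simp add: greedy_ratio_def)
  have eq: "greedy_ratio v c ?P j = greedy_ratio v c' ?P j"
    using same[OF \<open>j \<noteq> i\<close>] by (simp add: greedy_ratio_def)
  \<comment> \<open>The ratio of \<open>j\<close> is the same under both bids and no ratio is larger
    under \<open>c\<close>, so \<open>j\<close> is maximal there too.\<close>
  have "is_arg_max (greedy_ratio v c ?P) (\<lambda>k. k \<in> A - ?P) j"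
    using j(1) order_trans[OF le j(2)] by (simp add: is_arg_max_linorder eq)
  then have "l \<le> j"
    by (rule l(3))
  \<comment> \<open>Conversely \<open>l\<close> is maximal under \<open>c'\<close>, so tie-breaking
    yields both inequalities between \<open>j\<close> and \<open>l\<close>.\<close>
  moreover have "greedy_ratio v c' ?P m \<le> greedy_ratio v c' ?P l" if "m \<in> A - ?P" for m
    using order_trans[OF j(2)[OF that] order_trans[OF _ le]] l(2)[OF j(1)] by (simp add: eq)
  then have "j \<le> l"
    using l(1) by (intro j(3)) (auto simp: is_arg_max_linorder)
  ultimately show ?case
    using P by (simp add: j_def l_def greedy_prefix.simps(2))
qed simp

text \<open>Up to position \<open>k'\<close> both orders agree. If \<open>k'\<close> exceeded
  \<open>k\<close>, the common prefix of length \<open>Suc k\<close> would already contain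
  \<open>i\<close>.\<close>

lemma greedy_position_lower_bid:
  assumes "finite A" "valuation A v" "i \<in> A" "0 \<le> c' i" "c' i \<le> c i"
    and "\<And>j. j \<noteq> i \<Longrightarrow> c' j = c j"
    and "k < card A" "greedy_item A v c k = i" "k' < card A" "greedy_item A v c' k' = i"
  shows "greedy_prefix A v c' k' \<subseteq> greedy_prefix A v c k"
proof -
  have "i \<notin> greedy_prefix A v c' k'"
    using greedy_item_fresh[OF assms(1,9)] assms(10) by auto
  then have *: "greedy_prefix A v c' l = greedy_prefix A v c l" if "l \<le> k'" for l
    using that assms(9) greedy_prefix_mono[OF that, of A v c']
    by (intro greedy_prefix_lower_bid[where c' = c' and c = c, OF assms(1-5)] assms(6)) auto
  have "k' \<le> k"
  proof (rule ccontr)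
    assume "\<not> k' \<le> k"
    then have "i \<in> greedy_prefix A v c (Suc k)" "Suc k \<le> k'"
      using assms(8) by (auto simp: greedy_prefix_Suc)
    then show False
      using *[of "Suc k"] greedy_prefix_mono[of "Suc k" k' A v c'] \<open>i \<notin> greedy_prefix A v c' k'\<close>
      by auto
  qed
  then show ?thesis
    using * greedy_prefix_mono by fastforce
qed

section \<open>Threshold payments\<close>

text \<open>All bids above \<open>t\<close> lie in the set defining the threshold, so its infimum is
  at most each of them. Nonnegativity of \<open>t\<close> makes these bids admissible and covers the
  losers.\<close>

lemma threshold_payment_le:
  assumes "0 \<le> t" and "\<And>b. t < b \<Longrightarrow> i \<notin> f (c(i := b))"
  shows "threshold_payment f c i \<le> t"
proof -
  have "Inf {b. 0 \<le> b \<and> i \<notin> f (c(i := b))} \<le> b" if "t < b" for b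
    using assms that by (intro cInf_lower bdd_belowI[of _ 0]) auto
  then show ?thesis
    using assms dense_ge by (auto simp: threshold_payment_def)
qed

text \<open>The threshold \<open>Inf L\<close> depends on the bids of the others only. Monotonicity
  puts a winning cost at or below it and a losing cost at or above it, so the truth picks the better
  of the utilities \<open>Inf L - c i\<close> and 0. Rejection above \<open>B\<close> makes
  \<open>L\<close> nonempty.\<close>

lemma truthful_threshold_payments:
  assumes mono: "\<And>c i b. cost_vector A c \<Longrightarrow> i \<in> A \<Longrightarrow> i \<in> f c \<Longrightarrow> 0 \<le> b \<Longrightarrow> b \<le> c i
      \<Longrightarrow> i \<in> f (c(i := b))"
    and reject: "\<And>c i. i \<in> A \<Longrightarrow> B < c i \<Longrightarrow> i \<notin> f c"
  shows "truthful A (with_threshold_payments f)"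
  unfolding truthful_def
proof (intro allI ballI impI)
  fix c :: "'a \<Rightarrow> real" and i b
  assume c: "cost_vector A c" and i: "i \<in> A" and b: "0 \<le> (b :: real)"
  define L where "L = {b. 0 \<le> b \<and> i \<notin> f (c(i := b))}"
  have bdd: "bdd_below L"
    by (intro bdd_belowI[of _ 0]) (auto simp: L_def)
  \<comment> \<open>The sign of \<open>B\<close> is not fixed here, whereas \<open>L\<close>
    contains only nonnegative bids.\<close>
  have "max 0 (B + 1) \<in> L"
    using reject[OF i] by (auto simp: L_def)
  then have "L \<noteq> {}"
    by auto
  have "0 \<le> c i"
    using c i by (auto simp: cost_vector_def)
  have win: "c i \<le> Inf L" if "i \<in> f c"
  proof (rule cInf_greatest[OF \<open>L \<noteq> {}\<close>])
    fix x assume "x \<in> L"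
    then show "c i \<le> x"
      using mono[OF c i that, of x] by (force simp: L_def)
  qed
  have lose: "Inf L \<le> c i" if "i \<notin> f c"
    using that \<open>0 \<le> c i\<close> by (intro cInf_lower bdd) (auto simp: L_def)
  show "utility (with_threshold_payments f) i (c i) (c(i := b))
      \<le> utility (with_threshold_payments f) i (c i) c"
    using win lose
    by (auto simp: utility_def with_threshold_payments_def threshold_payment_def L_def[symmetric])
qed

section \<open>Greedy-OM\<close>

text \<open>Each seller has exactly one position, so the existential in \<open>greedy_OM\<close>
  reduces to the test there.\<close>

lemma greedy_OM_iff:
  assumes "finite A" "k < card A" "greedy_item A v c k = i"
  shows "i \<in> greedy_OM v Orc \<alpha> A B c
    \<longleftrightarrow> v (insert i (greedy_prefix A v c k)) \<le> \<alpha> * Orc (A - {i}) B c"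
proof -
  have "k' = k" if "k' < card A" "greedy_item A v c k' = i" for k'
    using that assms greedy_item_inj[OF assms(1)] by (auto simp: inj_on_def)
  then show ?thesis
    using assms unfolding greedy_OM_def greedy_prefix_Suc by blast
qed

lemma greedy_OM_subset: "finite A \<Longrightarrow> greedy_OM v Orc \<alpha> A B c \<subseteq> A"
  using greedy_item_fresh unfolding greedy_OM_def by blast

lemma is_oracle_subset: "is_oracle A v Orc \<Longrightarrow> X \<subseteq> A \<Longrightarrow> is_oracle X v Orc"
  unfolding is_oracle_def by (meson subset_trans)

lemma oracle_cong:
  assumes "is_oracle A v Orc" "X \<subseteq> A" "B > 0" "cost_vector X c" "\<And>i. i \<in> X \<Longrightarrow> c' i = c i"
  shows "Orc X B c' = Orc X B c"
  using assms unfolding is_oracle_def by blast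

lemma oracle_le_opt:
  assumes "is_oracle A v Orc" "X \<subseteq> A" "B > 0" "cost_vector X c"
  shows "Orc X B c \<le> opt v X B c"
  using assms unfolding is_oracle_def by blast

text \<open>The left side of the winning test cannot grow, as the prefix before \<open>i\<close>
  does not grow, and the right side ignores the bid of \<open>i\<close>.\<close>

lemma greedy_OM_lower_bid:
  assumes "finite A" "B > 0" "valuation A v" "is_oracle A v Orc" "cost_vector A c" "i \<in> A"
    and "i \<in> greedy_OM v Orc \<alpha> A B c" "0 \<le> b" "b \<le> c i"
  shows "i \<in> greedy_OM v Orc \<alpha> A B (c(i := b))"
proof -
  obtain k where k: "k < card A" "greedy_item A v c k = i"
    using greedy_item_surj[OF assms(1,6)] by blast
  obtain k' where k': "k' < card A" "greedy_item A v (c(i := b)) k' = i"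
    using greedy_item_surj[OF assms(1,6)] by blast
  have "greedy_prefix A v (c(i := b)) k' \<subseteq> greedy_prefix A v c k"
    using assms k k' by (intro greedy_position_lower_bid[where i = i]) auto
  then have "v (insert i (greedy_prefix A v (c(i := b)) k')) \<le> v (insert i (greedy_prefix A v c k))"
    using assms k greedy_prefix_subset[of A k v c] by (intro valuation_mono[of A]) auto
  moreover have "Orc (A - {i}) B (c(i := b)) = Orc (A - {i}) B c"
    using assms by (intro oracle_cong[OF assms(4)]) (auto simp: cost_vector_def)
  ultimately show ?thesis
    using assms k k' by (simp add: greedy_OM_iff)
qed

text \<open>\<open>V\<close> will be the value of the prefix up to the last winner. The marginals
  over \<open>insert i T\<close> of the members of an optimal set \<open>S\<close> for
  \<open>c\<close> sum to at least \<open>V\<close>; by the greedy choice after \<open>T\<close>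
  they are at most \<open>marginal v T i / b\<close> per unit of cost, and \<open>S\<close> costs at
  most \<open>B\<close>.\<close>

lemma greedy_OM_winning_bid_le:
  assumes "finite A" "B > 0" "valuation A v" "is_oracle A v Orc" "cost_vector A c"
    and k: "k < card A" "greedy_item A v c k = i"
    and wins: "i \<in> greedy_OM v Orc (1/2) A B (c(i := b))" and "c i \<le> b"
    and V: "2 * V \<le> opt v A B c"
  shows "b * V \<le> B * marginal v (greedy_prefix A v c k) i"
proof -
  let ?c = "c(i := b)"
  have i: "i \<in> A"
    using greedy_item_fresh[OF assms(1) k(1)] k(2) by auto
  have c0: "\<And>j. j \<in> A \<Longrightarrow> 0 \<le> c j"
    using assms by (auto simp: cost_vector_def)
  then have "0 \<le> b"
    using i \<open>c i \<le> b\<close> by force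
  obtain l where l: "l < card A" "greedy_item A v ?c l = i"
    using greedy_item_surj[OF assms(1) i] by blast
  define P where "P = greedy_prefix A v c k"
  define T where "T = greedy_prefix A v ?c l"
  have TA: "T \<subseteq> A" "\<not> A \<subseteq> T"
    using l greedy_prefix_subset[OF assms(1), of l] greedy_prefix_not_all[OF assms(1), of l]
    by (auto simp: T_def)
  \<comment> \<open>The roles are reversed: the original bid \<open>c i\<close> is the lower of the
    two.\<close>
  have "P \<subseteq> T"
    unfolding P_def T_def using assms k l i c0
    by (intro greedy_position_lower_bid[where i = i]) auto
  then have mP: "marginal v T i \<le> marginal v P i"
    using assms TA i by (intro marginal_antimono[of A]) auto
  have m0: "0 \<le> marginal v T j" if "j \<in> A" for j
    using marginal_nonneg[OF assms(3) TA(1) that] .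
  show ?thesis
  \<comment> \<open>For \<open>b = 0\<close> the ratio of \<open>i\<close> need not be finite, but
    the left-hand side is 0.\<close>
  proof (cases "b = 0")
    case True
    then show ?thesis
      using m0[OF i] mP \<open>B > 0\<close> by (simp add: P_def)
  next
    case False
    then have "b > 0"
      using \<open>0 \<le> b\<close> by simp
    obtain S where S: "S \<subseteq> A" "sum c S \<le> B" "opt v A B c = v S"
      using opt_attained[OF assms(1,2)] by blast
    have "finite S"
      using finite_subset[OF S(1) assms(1)] .
    have "v (insert i T) \<le> 1/2 * Orc (A - {i}) B ?c"
      using wins greedy_OM_iff[OF assms(1) l] by (simp add: T_def)
    also have "Orc (A - {i}) B ?c \<le> opt v (A - {i}) B ?c"
      using assms by (intro oracle_le_opt) (auto simp: cost_vector_def)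
    also have "opt v (A - {i}) B ?c = opt v (A - {i}) B c"
      by (rule opt_cong) auto
    also have "\<dots> \<le> opt v A B c"
      using assms by (intro opt_mono) auto
    finally have "2 * v (insert i T) \<le> v S"
      using S by simp
    \<comment> \<open>Both \<open>V\<close> and \<open>v (insert i T)\<close> are at most half of
      \<open>v S\<close>.\<close>
    then have "V \<le> v S - v (insert i T)"
      using V S by simp
    also have "v S \<le> v (insert i T \<union> S)"
      using S TA i assms by (intro valuation_mono[of A]) auto
    also have "\<dots> \<le> v (insert i T) + (\<Sum>j\<in>S. marginal v (insert i T) j)"
      using S TA i assms \<open>finite S\<close> by (intro valuation_Un_le[of A]) auto
    also have "(\<Sum>j\<in>S. marginal v (insert i T) j) \<le> (\<Sum>j\<in>S. c j * (marginal v T i / b))"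
    proof (rule sum_mono)
      fix j assume "j \<in> S"
      then have j: "j \<in> A"
        using S by auto
      show "marginal v (insert i T) j \<le> c j * (marginal v T i / b)"
      proof (cases "j \<in> insert i T")
        case True
        then have "marginal v (insert i T) j = 0"
          by (simp add: marginal_def insert_absorb)
        then show ?thesis
          using c0[OF j] m0[OF i] \<open>b > 0\<close> by simp
      next
        case False
        \<comment> \<open>Here \<open>j\<close> was still available when \<open>i\<close> was chosen
          after \<open>T\<close>, and its cost is unaffected by the bid of \<open>i\<close>.\<close>
        have "marginal v (insert i T) j \<le> marginal v T j"
          using assms TA i j by (intro marginal_antimono[of A]) auto
        also have "greedy_ratio v ?c T j \<le> greedy_ratio v ?c T i"
          using greedy_next_properties(2)[OF assms(1) TA(2), of j v ?c] False j l(2)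
          by (simp add: T_def greedy_item_def)
        then have "marginal v T j \<le> ?c j * (marginal v T i / ?c i)"
          by (rule greedy_ratio_leD) (use \<open>b > 0\<close> c0 i j m0 in auto)
        finally show ?thesis
          using False by simp
      qed
    qed
    also have "\<dots> = sum c S * (marginal v T i / b)"
      by (simp only: sum_distrib_right)
    also have "\<dots> \<le> B * (marginal v P i / b)"
      using S mP m0[OF i] \<open>b > 0\<close> \<open>B > 0\<close> by (intro mult_mono divide_right_mono) auto
    finally show ?thesis
      using \<open>b > 0\<close> by (simp add: P_def field_simps)
  qed
qed

text \<open>The factor \<open>2 * r\<close> combines the 1/2 in the failed test of the first
  rejected seller with the oracle ratio; the additional 1 pays for removing that seller from the
  optimum. If nobody is rejected, monotonicity suffices.\<close>

lemma greedy_OM_approx: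
  assumes "finite A" "B > 0" "valuation A v" "cost_vector A c" "r \<ge> 1"
    and Orc: "\<And>i. i \<in> A \<Longrightarrow> opt v (A - {i}) B c \<le> r * Orc (A - {i}) B c"
    and top: "m \<in> A" "\<And>i. i \<in> A \<Longrightarrow> v {i} \<le> v {m}"
  shows "opt v A B c \<le> 2 * r * v (greedy_OM v Orc (1/2) A B c) + (1 + 2 * r) * v {m}"
proof -
  let ?G = "greedy_OM v Orc (1/2) A B c"
  let ?P = "greedy_prefix A v c"
  have GA: "?G \<subseteq> A"
    using greedy_OM_subset assms by blast
  have "0 \<le> v ?G" "0 \<le> v {m}"
    using valuation_nonneg[OF assms(3)] GA top(1) by auto
  show ?thesis
  proof (cases "A \<subseteq> ?G")
    case True
    obtain S where S: "S \<subseteq> A" "opt v A B c = v S"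
      using opt_attained[OF assms(1,2)] by blast
    then have "opt v A B c \<le> v ?G"
      using valuation_mono[OF assms(3) _ GA, of S] True by auto
    also have "\<dots> \<le> 2 * r * v ?G"
      using \<open>0 \<le> v ?G\<close> \<open>r \<ge> 1\<close> mult_right_mono[of 1 "2 * r" "v ?G"] by simp
    also have "\<dots> \<le> 2 * r * v ?G + (1 + 2 * r) * v {m}"
      using \<open>0 \<le> v {m}\<close> \<open>r \<ge> 1\<close> by simp
    finally show ?thesis .
  next
    case False
    define rejected where "rejected = (\<lambda>k. k < card A \<and> greedy_item A v c k \<notin> ?G)"
    obtain j where j: "j \<in> A" "j \<notin> ?G"
      using False by blast
    obtain k0 where "k0 < card A" "greedy_item A v c k0 = j"
      using greedy_item_surj[OF assms(1) j(1)] by blast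
    then have "\<exists>k. rejected k"
      using j by (auto simp: rejected_def)
    define k where "k = (LEAST k. rejected k)"
    have k: "rejected k"
      unfolding k_def using \<open>\<exists>k. rejected k\<close> by (rule LeastI_ex)
    have less: "\<not> rejected l" if "l < k" for l
      using that not_less_Least unfolding k_def by blast
    define i where "i = greedy_item A v c k"
    have kA: "k < card A" "i \<notin> ?G"
      using k by (auto simp: rejected_def i_def)
    have i: "i \<in> A"
      using greedy_item_fresh[OF assms(1) kA(1)] by (auto simp: i_def)
    have PG: "?P k \<subseteq> ?G"
      using less kA(1) by (auto simp: greedy_prefix_eq_image rejected_def)
    have fail: "1/2 * Orc (A - {i}) B c \<le> v (insert i (?P k))"
      using kA greedy_OM_iff[OF assms(1) kA(1) i_def[symmetric]] by simp
    \<comment> \<open>\<open>?P k\<close> consists of winners only, and the single further item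
      \<open>i\<close> is charged to \<open>m\<close>.\<close>
    have "v (insert i (?P k)) = v (?P k) + marginal v (?P k) i"
      by (simp add: marginal_def)
    also have "v (?P k) \<le> v ?G"
      using valuation_mono[OF assms(3) PG GA] .
    also have "marginal v (?P k) i \<le> marginal v {} i"
      using PG GA assms i by (intro marginal_antimono[of A]) auto
    also have "\<dots> \<le> v {m}"
      using valuation_nonneg[of A v "{}"] assms(3) top(2)[OF i] by (simp add: marginal_def)
    finally have "Orc (A - {i}) B c \<le> 2 * (v ?G + v {m})"
      using fail by simp
    then have "r * Orc (A - {i}) B c \<le> r * (2 * (v ?G + v {m}))"
      using \<open>r \<ge> 1\<close> by (intro mult_left_mono) auto
    moreover have "opt v A B c \<le> opt v (A - {i}) B c + v {i}"
      using assms i by (intro opt_remove_le) auto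
    ultimately show ?thesis
      using Orc[OF i] top(2)[OF i] by (simp add: algebra_simps)
  qed
qed

section \<open>Random-OM\<close>

text \<open>Shows that a bid above the budget loses in either branch, which keeps thresholds
  meaningful and at most \<open>B\<close>.\<close>

lemma random_OM_run_subset:
  assumes "finite A" "\<And>X. X \<subseteq> A \<Longrightarrow> X \<noteq> {} \<Longrightarrow> istar X \<in> X"
  shows "random_OM_run v Orc istar \<alpha> A B coin c \<subseteq> {i \<in> A. c i \<le> B}"
proof (cases "{i \<in> A. c i \<le> B} = {}")
  case False
  then have "istar {i \<in> A. c i \<le> B} \<in> {i \<in> A. c i \<le> B}"
    by (intro assms(2)) auto
  then show ?thesis
    using assms(1) greedy_OM_subset[of "{i \<in> A. c i \<le> B}" v Orc \<alpha> B c]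
    by (simp add: random_OM_run_def Let_def)
qed (simp add: random_OM_run_def Let_def)

lemma affordable_update:
  assumes "i \<in> A" "c i \<le> B" "b \<le> (B :: real)"
  shows "{j \<in> A. (c(i := b)) j \<le> B} = {j \<in> A. c j \<le> B}"
  using assms by auto

text \<open>A winner is affordable, so a lower bid changes neither the reduced set of sellers nor
  its \<open>istar\<close>; only the greedy branch needs an argument.\<close>

lemma random_OM_run_lower_bid:
  assumes "finite A" "B > 0" "valuation A v" "is_oracle A v Orc"
    and "\<And>X. X \<subseteq> A \<Longrightarrow> X \<noteq> {} \<Longrightarrow> istar X \<in> X"
    and "cost_vector A c" "i \<in> A" "i \<in> random_OM_run v Orc istar \<alpha> A B coin c" "0 \<le> b" "b \<le> c i"
  shows "i \<in> random_OM_run v Orc istar \<alpha> A B coin (c(i := b))"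
proof -
  let ?A = "{j \<in> A. c j \<le> B}"
  have i: "i \<in> ?A"
    using random_OM_run_subset[OF assms(1,5)] assms(8) by blast
  then have "{j \<in> A. (c(i := b)) j \<le> B} = ?A"
    using assms by (intro affordable_update) auto
  moreover have "i \<in> greedy_OM v Orc \<alpha> ?A B (c(i := b))" if "i \<in> greedy_OM v Orc \<alpha> ?A B c"
  proof (rule greedy_OM_lower_bid[OF _ assms(2) _ _ _ i that assms(9,10)])
    show "valuation ?A v" "is_oracle ?A v Orc"
      using valuation_subset[OF assms(3)] is_oracle_subset[OF assms(4)] by auto
  qed (use assms(1,6) in \<open>auto simp: cost_vector_def\<close>)
  ultimately show ?thesis
    using assms(8) i by (auto simp: random_OM_run_def Let_def split: if_splits)
qed

section \<open>Budget feasibility of Random-OM\<close>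

lemma random_OM_run_payment_le:
  assumes "finite A" "B > 0" "\<And>X. X \<subseteq> A \<Longrightarrow> X \<noteq> {} \<Longrightarrow> istar X \<in> X"
  shows "threshold_payment (random_OM_run v Orc istar \<alpha> A B coin) c i \<le> B"
proof (rule threshold_payment_le)
  fix b assume "B < b"
  then show "i \<notin> random_OM_run v Orc istar \<alpha> A B coin (c(i := b))"
    using random_OM_run_subset[OF assms(1,3), of v Orc \<alpha> B coin "c(i := b)"] by auto
qed (use assms in auto)

text \<open>The winner at position \<open>k\<close> is paid at most \<open>B\<close> times the share
  of \<open>V\<close> gained at that position, and the shares telescope to at most 1. For
  \<open>V = 0\<close> all winners have value 0, so there is at most one, paid at most
  \<open>B\<close>.\<close>

lemma random_OM_run_feasible_greedy:
  assumes "finite A" "B > 0" "valuation A v" "is_oracle A v Orc"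
    and istar: "\<And>X. X \<subseteq> A \<Longrightarrow> X \<noteq> {} \<Longrightarrow> istar X \<in> X"
    and "card {i \<in> A. v {i} = 0} \<le> 1" "cost_vector A c"
  defines "f \<equiv> random_OM_run v Orc istar (1/2) A B True"
  shows "(\<Sum>i\<in>f c. threshold_payment f c i) \<le> B"
proof -
  define A' where "A' = {i \<in> A. c i \<le> B}"
  let ?P = "greedy_prefix A' v c"
  let ?item = "greedy_item A' v c"
  have sub: "A' \<subseteq> A"
    by (auto simp: A'_def)
  have cA': "cost_vector A' c"
    using assms(7) by (simp add: A'_def cost_vector_def)
  note A' = sub finite_subset[OF sub assms(1)] valuation_subset[OF assms(3) sub]
    is_oracle_subset[OF assms(4) sub] cA'
  have pB: "threshold_payment f c i \<le> B" for i
    unfolding f_def using assms(1,2) istar by (rule random_OM_run_payment_le)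
  define K where "K = {k. k < card A' \<and> ?item k \<in> f c}"
  have [simp]: "finite K"
    by (auto simp: K_def)
  have fA': "f c \<subseteq> A'"
    unfolding f_def A'_def using assms(1) istar by (rule random_OM_run_subset)
  have f_c: "f c = greedy_OM v Orc (1/2) A' B c" if "A' \<noteq> {}"
    using that unfolding f_def random_OM_run_def Let_def A'_def[symmetric] by simp
  have fK: "f c = ?item ` K"
  proof (intro subset_antisym subsetI)
    fix i assume i: "i \<in> f c"
    then obtain k where "k < card A'" "?item k = i"
      using fA' by (blast intro: greedy_item_surj[OF A'(2)])
    then show "i \<in> ?item ` K"
      using i by (auto simp: K_def)
  qed (auto simp: K_def)
  have inj: "inj_on ?item K"
    using greedy_item_inj[OF A'(2)] by (rule inj_on_subset) (auto simp: K_def)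
  show ?thesis
  proof (cases "K = {}")
    case True
    then show ?thesis
      using fK \<open>B > 0\<close> by simp
  next
    case False
    define l where "l = Max K"
    \<comment> \<open>Positions start at 0, so the prefix of length \<open>Suc l\<close> ends with
      the last winner.\<close>
    define V where "V = v (?P (Suc l))"
    have l: "l \<in> K" and le_l: "\<And>k. k \<in> K \<Longrightarrow> k \<le> l"
      using False by (auto simp: l_def)
    have "A' \<noteq> {}"
      using l by (auto simp: K_def)
    note f_c = f_c[OF this]
    have lA: "l < card A'" "?item l \<in> f c"
      using l by (auto simp: K_def)
    have PlA: "?P (Suc l) \<subseteq> A'"
      using lA A' by (intro greedy_prefix_subset) auto
    have V0: "0 \<le> V"
      unfolding V_def using A' PlA by (intro valuation_nonneg)
    have "V \<le> 1/2 * Orc (A' - {?item l}) B c"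
      using lA f_c greedy_OM_iff[OF A'(2) lA(1) refl] by (simp add: V_def greedy_prefix_Suc)
    also have "Orc (A' - {?item l}) B c \<le> opt v (A' - {?item l}) B c"
      using A' assms(2) by (intro oracle_le_opt) (auto simp: cost_vector_def)
    also have "\<dots> \<le> opt v A' B c"
      using A' assms(2) by (intro opt_mono) auto
    finally have V: "2 * V \<le> opt v A' B c"
      by simp
    show ?thesis
    proof (cases "V = 0")
      case True
      have "v {i} = 0" if i: "i \<in> f c" for i
      proof -
        obtain k where k: "k \<in> K" "i = ?item k"
          using i fK by auto
        have "i \<in> ?P (Suc k)"
          using k by (simp add: greedy_prefix_Suc)
        then have "i \<in> ?P (Suc l)"
          using greedy_prefix_mono[of "Suc k" "Suc l" A' v c] le_l[OF k(1)] by auto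
        then have "v {i} \<le> V"
          unfolding V_def using A' PlA by (intro valuation_mono) auto
        moreover have "0 \<le> v {i}"
          using A' i fA' by (intro valuation_nonneg[of A']) auto
        ultimately show ?thesis
          using True by simp
      qed
      then have "card (f c) \<le> card {i \<in> A. v {i} = 0}"
        using fA' A' assms(1) by (intro card_mono) auto
      then have "real (card (f c)) * B \<le> 1 * B"
        using assms(2,6) by (intro mult_right_mono) auto
      moreover have "(\<Sum>i\<in>f c. threshold_payment f c i) \<le> real (card (f c)) * B"
        using pB by (intro sum_bounded_above) auto
      ultimately show ?thesis
        by simp
    next
      case False
      then have "V > 0"
        using V0 by simp
      have pay: "threshold_payment f c (?item k) \<le> B * (v (?P (Suc k)) - v (?P k)) / V"
        if k: "k \<in> K" for k
      proof -
        define i where "i = ?item k"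
        have kA: "k < card A'" "?item k = i" "i \<in> f c" "i \<in> A'"
          using k fA' by (auto simp: K_def i_def)
        have PkA: "?P k \<subseteq> A'"
          using kA A' by (intro greedy_prefix_subset) auto
        have bound: "b * V \<le> B * marginal v (?P k) i"
          if "c i \<le> b" "i \<in> f (c(i := b))" for b
        proof (rule greedy_OM_winning_bid_le[OF A'(2) assms(2) A'(3-5) kA(1,2) _ that(1) V])
          \<comment> \<open>As a winner, \<open>i\<close> is affordable with bid \<open>b\<close>,
            so the greedy branch still runs on \<open>A'\<close>.\<close>
          have "i \<in> {j \<in> A. (c(i := b)) j \<le> B}"
            using random_OM_run_subset[OF assms(1) istar] that(2) unfolding f_def by blast
          then have "{j \<in> A. (c(i := b)) j \<le> B} = A'"
            unfolding A'_def using kA(4) by (intro affordable_update) (auto simp: A'_def)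
          then show "i \<in> greedy_OM v Orc (1/2) A' B (c(i := b))"
            using that(2) \<open>A' \<noteq> {}\<close> by (simp only: f_def random_OM_run_def Let_def if_True if_False)
        qed
        \<comment> \<open>The declared cost is itself a winning bid; hence any bid above this bound
          exceeds \<open>c i\<close>, as \<open>bound\<close> requires.\<close>
        have ci: "c i \<le> B * marginal v (?P k) i / V"
          using bound[of "c i"] kA(3) \<open>V > 0\<close> by (simp add: pos_le_divide_eq)
        have "threshold_payment f c i \<le> B * marginal v (?P k) i / V"
        proof (rule threshold_payment_le)
          show "0 \<le> B * marginal v (?P k) i / V"
            using \<open>B > 0\<close> \<open>V > 0\<close> marginal_nonneg[OF A'(3) PkA kA(4)] by simp
        next
          fix b assume b: "B * marginal v (?P k) i / V < b"
          show "i \<notin> f (c(i := b))"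
          proof
            assume "i \<in> f (c(i := b))"
            then have "b * V \<le> B * marginal v (?P k) i"
              using b ci by (intro bound) auto
            then show False
              using b \<open>V > 0\<close> by (simp add: pos_divide_less_eq)
          qed
        qed
        then show ?thesis
          by (simp add: i_def marginal_def greedy_prefix_Suc)
      qed
      have inc: "v (?P k) \<le> v (?P (Suc k))" if "k < Suc l" for k
        using that lA A' PlA greedy_prefix_mono[of "Suc k" "Suc l" A' v c]
        by (intro valuation_mono[of A'] greedy_prefix_mono) auto
      have "(\<Sum>i\<in>f c. threshold_payment f c i) = (\<Sum>k\<in>K. threshold_payment f c (?item k))"
        unfolding fK using inj by (simp add: sum.reindex)
      also have "\<dots> \<le> (\<Sum>k\<in>K. B * (v (?P (Suc k)) - v (?P k)) / V)"
        using pay by (rule sum_mono)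
      \<comment> \<open>Losing positions are added as well; their increments are nonnegative by
        \<open>inc\<close>.\<close>
      also have "\<dots> \<le> (\<Sum>k<Suc l. B * (v (?P (Suc k)) - v (?P k)) / V)"
        using le_l inc \<open>V > 0\<close> \<open>B > 0\<close>
        by (intro sum_mono2) (auto simp: less_Suc_eq_le)
      also have "\<dots> = B * (\<Sum>k<Suc l. v (?P (Suc k)) - v (?P k)) / V"
        by (simp only: sum_distrib_left sum_divide_distrib)
      also have "(\<Sum>k<Suc l. v (?P (Suc k)) - v (?P k)) = V - v {}"
        by (subst sum_lessThan_telescope) (simp add: V_def)
      \<comment> \<open>Since \<open>v {}\<close> need not be 0, the telescoped sum can fall short
        of \<open>V\<close>.\<close>
      also have "B * (V - v {}) / V \<le> B"
        using \<open>V > 0\<close> \<open>B > 0\<close> valuation_nonneg[OF A'(3), of "{}"] by (simp add: pos_divide_le_eq)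
      finally show ?thesis .
    qed
  qed
qed

text \<open>Losers are paid nothing; outside the greedy branch there is at most one winner, whose
  threshold is at most \<open>B\<close>.\<close>

lemma random_OM_run_feasible:
  fixes coin :: bool
  assumes "finite A" "B > 0" "valuation A v" "is_oracle A v Orc"
    and istar: "\<And>X. X \<subseteq> A \<Longrightarrow> X \<noteq> {} \<Longrightarrow> istar X \<in> X"
    and "card {i \<in> A. v {i} = 0} \<le> 1" "cost_vector A c"
  defines "f \<equiv> random_OM_run v Orc istar (1/2) A B coin"
  shows "(\<Sum>i\<in>A. threshold_payment f c i) \<le> B"
proof -
  have "f c \<subseteq> A"
    unfolding f_def using random_OM_run_subset[OF assms(1) istar] by blast
  then have "(\<Sum>i\<in>A. threshold_payment f c i) = (\<Sum>i\<in>f c. threshold_payment f c i)"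
    using assms(1) by (intro sum.mono_neutral_right) (auto simp: threshold_payment_def)
  also have "\<dots> \<le> B"
  proof (cases coin)
    case True
    then show ?thesis
      using random_OM_run_feasible_greedy[OF assms(1-7)] by (simp add: f_def)
  next
    case False
    then have "f c = {} \<or> f c = {istar {i \<in> A. c i \<le> B}}"
      by (simp add: f_def random_OM_run_def Let_def)
    then show ?thesis
      using random_OM_run_payment_le[OF assms(1,2) istar] \<open>B > 0\<close> by (auto simp: f_def)
  qed
  finally show ?thesis .
qed

text \<open>With parameter 1/2, the probabilities of the two branches multiplied by
  \<open>1 + 4 * r\<close> become \<open>2 * r\<close> and \<open>1 + 2 * r\<close>, the
  coefficients in \<open>greedy_OM_approx\<close>.\<close>

lemma random_OM_approx:
  assumes "finite A" "B > 0" "valuation A v" "r \<ge> 1" "approx_oracle A v r Orc"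
    and istar: "\<And>X. X \<subseteq> A \<Longrightarrow> X \<noteq> {} \<Longrightarrow> is_arg_max (\<lambda>i. v {i}) (\<lambda>i. i \<in> X) (istar X)"
    and c: "cost_vector A c"
  shows "opt v A B c
    \<le> (1 + 4 * r) * measure_pmf.expectation (random_OM v Orc r istar (1/2) A B) (\<lambda>f. v (f c))"
proof -
  define A' where "A' = {i \<in> A. c i \<le> B}"
  let ?f = "random_OM_run v Orc istar (1/2) A B"
  define p where "p = r / (1/2 + 2 * r)"
  have p: "0 \<le> p" "p \<le> 1" "(1 + 4 * r) * p = 2 * r"
    using \<open>r \<ge> 1\<close> by (auto simp: p_def field_simps)
  have "measure_pmf.expectation (random_OM v Orc r istar (1/2) A B) (\<lambda>f. v (f c))
      = p * v (?f True c) + (1 - p) * v (?f False c)"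
    unfolding random_OM_def p_def[symmetric] using p
    by simp
  also have "(1 + 4 * r) * \<dots>
      = ((1 + 4 * r) * p) * v (?f True c) + ((1 + 4 * r) - (1 + 4 * r) * p) * v (?f False c)"
    by (simp add: algebra_simps)
  finally have E: "(1 + 4 * r) * measure_pmf.expectation (random_OM v Orc r istar (1/2) A B) (\<lambda>f. v (f c))
      = 2 * r * v (?f True c) + (1 + 2 * r) * v (?f False c)"
    by (simp add: p)
  have A': "A' \<subseteq> A" "finite A'" "valuation A' v" "cost_vector A' c"
    using assms(1) c valuation_subset[OF assms(3), of A'] by (auto simp: A'_def cost_vector_def)
  have opt: "opt v A B c = opt v A' B c"
    unfolding A'_def using assms(1,2) c by (rule opt_affordable)
  show ?thesis
  proof (cases "A' = {}")
    \<comment> \<open>Nobody is affordable: both branches return the empty set, whose value may be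
      positive and equals the optimum.\<close>
    case True
    then have run: "?f coin c = {}" for coin
      by (simp add: random_OM_run_def A'_def Let_def)
    obtain S where "S \<subseteq> A'" "opt v A' B c = v S"
      using opt_attained[OF A'(2) assms(2)] by blast
    then have "opt v A B c = v {}"
      using True opt by simp
    also have "\<dots> \<le> 2 * r * v {} + (1 + 2 * r) * v {}"
      using valuation_nonneg[OF A'(3), of "{}"] \<open>r \<ge> 1\<close> by (simp add: algebra_simps)
    finally show ?thesis
      by (simp only: E run)
  next
    case False
    have run: "?f True c = greedy_OM v Orc (1/2) A' B c" "?f False c = {istar A'}"
      using False unfolding random_OM_run_def Let_def A'_def[symmetric] by simp_all
    have "opt v (A' - {i}) B c \<le> r * Orc (A' - {i}) B c" for i
    proof -
      have "A' - {i} \<subseteq> A" "cost_vector (A' - {i}) c"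
        using A' by (auto simp: cost_vector_def)
      then show ?thesis
        using assms(2,5) unfolding approx_oracle_def by blast
    qed
    moreover have "istar A' \<in> A'" "\<And>i. i \<in> A' \<Longrightarrow> v {i} \<le> v {istar A'}"
      using istar[OF A'(1) False] by (auto simp: is_arg_max_linorder)
    ultimately show ?thesis
      unfolding E run opt using A' assms(2,4) by (intro greedy_OM_approx)
  qed
qed

text \<open>Truthfulness and budget feasibility are checked for each outcome of the coin; only the
  approximation averages over it. The condition on zero-valued sellers rules out several winners of
  total value 0.\<close>

theorem theorem3p15:
  fixes A :: "'a::linorder set" and v :: "'a set \<Rightarrow> real" and B r :: real
    and Orc :: "'a oracle_fun" and istar :: "'a set \<Rightarrow> 'a"
  assumes "finite A" and "B > 0" and "valuation A v"
    and "r \<ge> 1" and "approx_oracle A v r Orc"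
    and "\<And>X. X \<subseteq> A \<Longrightarrow> X \<noteq> {} \<Longrightarrow> is_arg_max (\<lambda>i. v {i}) (\<lambda>i. i \<in> X) (istar X)"
  defines "R \<equiv> random_OM v Orc r istar (1/2) A B"
  shows "universally_truthful A (map_pmf with_threshold_payments R)
    \<and> (card {i \<in> A. v {i} = 0} \<le> 1
        \<longrightarrow> budget_feasible A B (map_pmf with_threshold_payments R))
    \<and> (\<forall>c. cost_vector A c \<longrightarrow>
         opt v A B c \<le> (1 + 4 * r) * measure_pmf.expectation R (\<lambda>f. v (f c)))"
proof (intro conjI impI allI)
  have orc: "is_oracle A v Orc"
    using assms(5) by (simp add: approx_oracle_def)
  have istar: "istar X \<in> X" if "X \<subseteq> A" "X \<noteq> {}" for X
    using assms(6)[OF that] by (simp add: is_arg_max_def)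
  have run: "\<exists>coin. M = with_threshold_payments (random_OM_run v Orc istar (1/2) A B coin)"
    if "M \<in> set_pmf (map_pmf with_threshold_payments R)" for M
    using that by (auto simp: R_def random_OM_def)
  have "truthful A (with_threshold_payments (random_OM_run v Orc istar (1/2) A B coin))" for coin
  proof (rule truthful_threshold_payments)
    fix c :: "'a \<Rightarrow> real" and i b
    assume *: "cost_vector A c" "i \<in> A" "i \<in> random_OM_run v Orc istar (1/2) A B coin c"
      "0 \<le> b" "b \<le> c i"
    show "i \<in> random_OM_run v Orc istar (1/2) A B coin (c(i := b))"
      by (rule random_OM_run_lower_bid[OF assms(1-3) orc _ *]) (rule istar)
  next
    fix c :: "'a \<Rightarrow> real" and i
    assume "B < c i"
    moreover have "random_OM_run v Orc istar (1/2) A B coin c \<subseteq> {i \<in> A. c i \<le> B}"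
      using assms(1) istar by (rule random_OM_run_subset)
    ultimately show "i \<notin> random_OM_run v Orc istar (1/2) A B coin c"
      by auto
  qed
  then show "universally_truthful A (map_pmf with_threshold_payments R)"
    using run unfolding universally_truthful_def by blast
  show "budget_feasible A B (map_pmf with_threshold_payments R)" if "card {i \<in> A. v {i} = 0} \<le> 1"
    unfolding budget_feasible_def
  proof (intro ballI allI impI)
    fix M c assume M: "M \<in> set_pmf (map_pmf with_threshold_payments R)" and c: "cost_vector A c"
    obtain coin where "M = with_threshold_payments (random_OM_run v Orc istar (1/2) A B coin)"
      using run[OF M] by blast
    moreover have "(\<Sum>i\<in>A. threshold_payment (random_OM_run v Orc istar (1/2) A B coin) c i) \<le> B"
      by (rule random_OM_run_feasible[OF assms(1-3) orc _ that c]) (rule istar)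
    ultimately show "(\<Sum>i\<in>A. snd M c i) \<le> B"
      by (simp add: with_threshold_payments_def)
  qed
  show "opt v A B c \<le> (1 + 4 * r) * measure_pmf.expectation R (\<lambda>f. v (f c))" if "cost_vector A c" for c
    unfolding R_def using assms(1-6) that by (rule random_OM_approx)
qed

end
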